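(* For every matroid $M$ of rank $r$, $$[t]\,Q_M(t) = |w_{1,r}| - |w_{0,r-1}|,$$ where $[t]p(t)$ denotes the coefficient of $t$ in a polynomial $p(t)$.
   Context: For a matroid $M$ of rank $r$ with ground set $E$, let $\mathscr{L}(M)$ be its lattice of flats ordered by inclusion, with minimum $\hat 0$ (the closure of the empty set) and maximum $E$, rank function $\operatorname{rk}$ and Möbius function $\mu$ (with $\mu(F,G)=0$ unless $F\le G$). The characteristic polynomial is $\chi_M(t)=\sum_{F\in\mathscr{L}(M)}\mu(\hat 0,F)\,t^{r-\operatorname{rk}F}$. For a flat $F$, $M_F$ is the restriction of $M$ to $F$ (lattice of flats $[\hat 0,F]$, rank $\operatorname{rk}F$) and $M^F$ is the contraction $M/F$ (lattice of flats $[F,E]$, rank $r-\operatorname{rk}F$); all quantities depend only on the lattice of flats. The Kazhdan–Lusztig polynomial $P_M(t)$ and inverse Kazhdan–Lusztig polynomial $Q_M(t)$ are the unique assignment of polynomials in $\mathbb{Z}[t]$ to every matroid such that: if $r=0$ then $P_M=Q_M=1$; if $r>0$ then $\deg P_M<r/2$ and $\deg Q_M<r/2$; and for every $M$, $t^rP_M(t^{-1})=\sum_{F\in\mathscr{L}(M)}\chi_{M_F}(t)P_{M^F}(t)$ and $(-1)^r t^rQ_M(t^{-1})=\sum_{F\in\mathscr{L}(M)}(-1)^{\operatorname{rk}F}Q_{M_F}(t)\,t^{r-\operatorname{rk}F}\chi_{M^F}(t^{-1})$. The doubly-indexed Whitney numbers of the first kind are $w_{i,j}=\sum_{\operatorname{rk}F=i,\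 \operatorname{rk}G=j}\mu(F,G)$, the sum over pairs of flats of ranks $i$ and $j$. *)

theory Defs
  imports "HOL-Computational_Algebra.Polynomial"
begin

section \<open>Matroids\<close>

text \<open>A matroid is a pair \<open>(E, \<I>)\<close> of a finite ground set and its family of independent sets.\<close>

type_synonym 'a matroid = "'a set \<times> 'a set set"

abbreviation ground :: "'a matroid \<Rightarrow> 'a set" where
  "ground M \<equiv> fst M"

abbreviation indeps :: "'a matroid \<Rightarrow> 'a set set" where
  "indeps M \<equiv> snd M"

definition is_matroid :: "'a matroid \<Rightarrow> bool" where
  "is_matroid M \<longleftrightarrow>
     finite (ground M) \<and>
     indeps M \<subseteq> Pow (ground M) \<and>
     {} \<in> indeps M \<and>
     (\<forall>J\<in>indeps M. \<forall>I. I \<subseteq> J \<longrightarrow> I \<in> indeps M) \<and>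
     (\<forall>I\<in>indeps M. \<forall>J\<in>indeps M. card I < card J \<longrightarrow> (\<exists>x\<in>J - I. insert x I \<in> indeps M))"

definition rk :: "'a matroid \<Rightarrow> 'a set \<Rightarrow> nat" where
  "rk M X = Max (card ` {I \<in> indeps M. I \<subseteq> X})"

definition mrank :: "'a matroid \<Rightarrow> nat" where
  "mrank M = rk M (ground M)"

definition mclosure :: "'a matroid \<Rightarrow> 'a set \<Rightarrow> 'a set" where
  "mclosure M X = {x \<in> ground M. rk M (insert x X) = rk M X}"

definition flats :: "'a matroid \<Rightarrow> 'a set set" where
  "flats M = {F. F \<subseteq> ground M \<and> mclosure M F = F}"

text \<open>In the notation of the literature on Kazhdan--Lusztig polynomials of matroids, the restriction
  to a flat \<open>F\<close> is \<open>M\<^sub>F\<close> and the contraction \<open>M/F\<close> is \<open>M\<^sup>F\<close>.\<close>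

definition mrestrict :: "'a matroid \<Rightarrow> 'a set \<Rightarrow> 'a matroid" where
  "mrestrict M F = (F, {I \<in> indeps M. I \<subseteq> F})"

definition mcontract :: "'a matroid \<Rightarrow> 'a set \<Rightarrow> 'a matroid" where
  "mcontract M F = (ground M - F, {I. I \<subseteq> ground M - F \<and> rk M (I \<union> F) = card I + rk M F})"


section \<open>Moebius function and characteristic polynomial\<close>

text \<open>The guard \<open>finite P\<close> only serves termination.\<close>

function moebius :: "'b::order set \<Rightarrow> 'b \<Rightarrow> 'b \<Rightarrow> int" where
  "moebius P x y =
     (if finite P \<and> x \<in> P \<and> y \<in> P \<and> x \<le> y
      then (if x = y then 1 else - (\<Sum>z\<in>{z\<in>P. x \<le> z \<and> z < y}. moebius P x z))
      else 0)"
  by pat_completeness auto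
termination
proof (relation "measure (\<lambda>(P, x, y). card {z\<in>P. z \<le> y})", goal_cases)
  case (2 P x y z)
  then have "{u\<in>P. u \<le> z} \<subseteq> {u\<in>P. u \<le> y}" "y \<in> {u\<in>P. u \<le> y}" "y \<notin> {u\<in>P. u \<le> z}"
    by auto
  then have "{u\<in>P. u \<le> z} \<subset> {u\<in>P. u \<le> y}"
    by blast
  with 2 show ?case
    by (simp add: psubset_card_mono)
qed simp

declare moebius.simps [simp del]

lemma sum_moebius:
  assumes "finite P" "x \<in> P" "y \<in> P" "x \<le> y"
  shows "(\<Sum>z\<in>{z\<in>P. x \<le> z \<and> z \<le> y}. moebius P x z) = (if x = y then 1 else 0)"
proof (cases "x = y")
  case True
  then have "{z\<in>P. x \<le> z \<and> z \<le> y} = {y}" using assms by auto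
  then show ?thesis using True assms by (simp add: moebius.simps [of P y y])
next
  case False
  then have "{z\<in>P. x \<le> z \<and> z \<le> y} = insert y {z\<in>P. x \<le> z \<and> z < y}"
    using assms by (auto simp: le_less)
  then show ?thesis using False assms by (simp add: moebius.simps [of P x y])
qed

abbreviation flat_moebius :: "'a matroid \<Rightarrow> 'a set \<Rightarrow> 'a set \<Rightarrow> int" where
  "flat_moebius M \<equiv> moebius (flats M)"

definition char_poly :: "'a matroid \<Rightarrow> int poly" where
  "char_poly M =
     (\<Sum>F\<in>flats M. monom (flat_moebius M (mclosure M {}) F) (mrank M - rk M F))"


section \<open>Inverse Kazhdan--Lusztig polynomials\<close>

text \<open>\<open>rev_poly n p\<close> is \<open>t^n p(1/t)\<close>, to be used only when \<open>degree p \<le> n\<close>.\<close>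

definition rev_poly :: "nat \<Rightarrow> 'a::comm_monoid_add poly \<Rightarrow> 'a poly" where
  "rev_poly n p = (\<Sum>i\<le>n. monom (coeff p i) (n - i))"

lemma poly_rev_poly:
  fixes p :: "'a::field poly"
  assumes "degree p \<le> n" "x \<noteq> 0"
  shows "poly (rev_poly n p) x = x ^ n * poly p (inverse x)"
proof -
  have "poly p (inverse x) = (\<Sum>i\<le>n. coeff p i * inverse x ^ i)"
    unfolding poly_altdef
    by (rule sum.mono_neutral_left) (use assms in \<open>auto simp: coeff_eq_0\<close>)
  moreover have "(\<Sum>i\<le>n. coeff p i * x ^ (n - i)) = (\<Sum>i\<le>n. x ^ n * (coeff p i * inverse x ^ i))"
    by (rule sum.cong) (use assms in \<open>auto simp: power_diff field_simps\<close>)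
  ultimately show ?thesis
    by (simp only: rev_poly_def poly_sum poly_monom sum_distrib_left)
qed

text \<open>The defining conditions for the family \<open>M \<mapsto> Q\<^sub>M\<close>. They do not involve the family \<open>P\<^sub>M\<close>.
  In both uses of \<open>rev_poly\<close> the degree bound holds: \<open>2 * degree (Q M) < mrank M\<close>
  (or \<open>Q M = 1\<close>), and \<open>char_poly (mcontract M F)\<close> has degree at most
  \<open>mrank (mcontract M F) = mrank M - rk M F\<close>.\<close>

definition inverse_KL_family :: "('a matroid \<Rightarrow> int poly) \<Rightarrow> bool" where
  "inverse_KL_family Q \<longleftrightarrow>
     (\<forall>M. is_matroid M \<longrightarrow>
        (mrank M = 0 \<longrightarrow> Q M = 1) \<and>
        (mrank M > 0 \<longrightarrow> 2 * degree (Q M) < mrank M) \<and>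
        (-1) ^ mrank M * rev_poly (mrank M) (Q M) =
          (\<Sum>F\<in>flats M. (-1) ^ rk M F * Q (mrestrict M F)
             * rev_poly (mrank M - rk M F) (char_poly (mcontract M F))))"

text \<open>\<open>Q\<^sub>M\<close> is the value at \<open>M\<close> of the unique such family. As the type \<open>'a matroid\<close> also contains
  pairs that are not matroids, on which a family is unconstrained, the definite description
  is taken of the value at \<open>M\<close> rather than of the family.\<close>

definition inverse_KL :: "'a matroid \<Rightarrow> int poly" where
  "inverse_KL M = (THE q. \<exists>Q. inverse_KL_family Q \<and> q = Q M)"


section \<open>Whitney numbers of the first kind\<close>

text \<open>Indices are integers, so that a Whitney number with a negative index is an empty sum:
  for a matroid of rank 0, \<open>w(0,r-1) = 0\<close>.\<close>

definition whitney1 :: "'a matroid \<Rightarrow> int \<Rightarrow> int \<Rightarrow> int" where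
  "whitney1 M i j =
     (\<Sum>F\<in>{F\<in>flats M. int (rk M F) = i}. \<Sum>G\<in>{G\<in>flats M. int (rk M G) = j}. flat_moebius M F G)"

end

theory Submission
  imports Defs
begin

text \<open>
  The family exists because the equation determines \<open>\<plusminus>(t\<^sup>rQ\<^sub>M(1/t) - Q\<^sub>M(t))\<close> from the proper
  restrictions of \<open>M\<close>, and this remainder is antisymmetric under \<open>p \<mapsto> t\<^sup>rp(1/t)\<close> by the
  kernel identity for characteristic polynomials of intervals. Comparing coefficients of
  \<open>t\<^bsup>r-1\<^esup>\<close> in the equation, the degree bounds kill all flats of rank at least two, which gives
  \<open>(-1)\<^sup>r[t]Q\<^sub>M = w\<^bsub>0,r-1\<^esub> - w\<^bsub>1,r\<^esub>\<close>. The absolute values come from Rota's theorem that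
  \<open>\<mu>(F,G)\<close> has sign \<open>(-1)\<^bsup>rk G - rk F\<^esup>\<close>, proved with Weisner's theorem.
\<close>


section \<open>Rank and closure\<close>

text \<open>\<open>inverse_KL\<close> is a definite description, so nothing can be read off it
  before a family meeting all conditions has been constructed. The obstacle is overdetermination:
  the degree bound leaves only the coefficients below degree r/2 free, while the equation constrains
  every degree. The lower half determines \<open>Q M\<close>; antisymmetry of the remainder makes
  the upper half agree and, for even r, forces the coefficient at r/2 to vanish. Contractions are
  traded for intervals of \<open>flats M\<close>, so that all double sums live in one finite poset.
  In the last step both Whitney numbers carry the same sign (-1)^(r-1), which is why a difference of
  absolute values appears.\<close>

context
  fixes M :: "'a matroid"
  assumes M: "is_matroid M"
begin

lemma finite_ground: "finite (ground M)"
  using M by (simp add: is_matroid_def)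

lemma indep_subset_ground: "I \<in> indeps M \<Longrightarrow> I \<subseteq> ground M"
  using M by (auto simp: is_matroid_def)

lemma indep_finite: "I \<in> indeps M \<Longrightarrow> finite I"
  using indep_subset_ground finite_ground finite_subset by blast

lemma finite_indeps: "finite (indeps M)"
  using M finite_ground finite_subset[of "indeps M" "Pow (ground M)"] by (simp add: is_matroid_def)

lemma indep_empty: "{} \<in> indeps M"
  using M by (simp add: is_matroid_def)

lemma indep_subset: "J \<in> indeps M \<Longrightarrow> I \<subseteq> J \<Longrightarrow> I \<in> indeps M"
  using M unfolding is_matroid_def by blast

lemma indep_augment:
  "I \<in> indeps M \<Longrightarrow> J \<in> indeps M \<Longrightarrow> card I < card J \<Longrightarrow> \<exists>x\<in>J - I. insert x I \<in> indeps M"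
  using M unfolding is_matroid_def by blast

lemma card_le_rk:
  assumes "I \<in> indeps M" "I \<subseteq> X" shows "card I \<le> rk M X"
  unfolding rk_def using assms finite_indeps by (intro Max_ge) auto

lemma rk_attained:
  obtains I where "I \<in> indeps M" "I \<subseteq> X" "card I = rk M X"
proof -
  have "rk M X \<in> card ` {I \<in> indeps M. I \<subseteq> X}"
    unfolding rk_def using finite_indeps indep_empty by (intro Max_in) auto
  then show ?thesis using that by auto
qed

lemma rk_mono: "X \<subseteq> Y \<Longrightarrow> rk M X \<le> rk M Y"
  by (metis rk_attained card_le_rk order_trans)

lemma rk_le_card: "finite X \<Longrightarrow> rk M X \<le> card X"
  by (metis rk_attained card_mono)

lemma rk_empty: "rk M {} = 0"
  using rk_le_card[of "{}"] by simp

text \<open>Augment \<open>I\<close> repeatedly from a maximum independent subset of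
  \<open>X\<close>; the deficit \<open>rk M X - card I\<close> drops each time.\<close>

lemma indep_extend:
  assumes "I \<in> indeps M" "I \<subseteq> X"
  obtains J where "J \<in> indeps M" "I \<subseteq> J" "J \<subseteq> X" "card J = rk M X"
  using assms
proof (induction "rk M X - card I" arbitrary: I thesis rule: less_induct)
  case less
  show ?case
  proof (cases "card I = rk M X")
    case True
    then show ?thesis using less.prems by blast
  next
    case False
    then have lt: "card I < rk M X" using card_le_rk less.prems by (metis le_neq_implies_less)
    obtain B where B: "B \<in> indeps M" "B \<subseteq> X" "card B = rk M X" by (rule rk_attained)
    with lt less.prems obtain x where x: "x \<in> B - I" "insert x I \<in> indeps M"
      using indep_augment by metis
    have "rk M X - card (insert x I) < rk M X - card I"
      using x lt less.prems(2) indep_finite by auto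
    from less.hyps[OF this _ x(2)] obtain J
      where "J \<in> indeps M" "insert x I \<subseteq> J" "J \<subseteq> X" "card J = rk M X"
      using x B less.prems by auto
    then show ?thesis using less.prems(1) by auto
  qed
qed

text \<open>Extend a basis \<open>I\<close> of the intersection to a basis \<open>J\<close> of the
  union. The traces of \<open>J\<close> on \<open>X\<close> and \<open>Y\<close> are independent,
  and their overlap contains \<open>I\<close>, so counting \<open>J\<close> by inclusion-exclusion
  gives the bound.\<close>

lemma rk_submodular: "rk M (X \<union> Y) + rk M (X \<inter> Y) \<le> rk M X + rk M Y"
proof -
  obtain I where I: "I \<in> indeps M" "I \<subseteq> X \<inter> Y" "card I = rk M (X \<inter> Y)" by (rule rk_attained)
  then obtain J where J: "J \<in> indeps M" "I \<subseteq> J" "J \<subseteq> X \<union> Y" "card J = rk M (X \<union> Y)"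
    using indep_extend[of I "X \<union> Y"] by blast
  have fin: "finite J" using J indep_finite by blast
  have "(J \<inter> X) \<union> (J \<inter> Y) = J" using J by auto
  then have "card (J \<inter> X) + card (J \<inter> Y) = card J + card ((J \<inter> X) \<inter> (J \<inter> Y))"
    using fin card_Un_Int[of "J \<inter> X" "J \<inter> Y"] by simp
  moreover have "card I \<le> card ((J \<inter> X) \<inter> (J \<inter> Y))"
    using fin I J by (intro card_mono) auto
  moreover have "card (J \<inter> X) \<le> rk M X" "card (J \<inter> Y) \<le> rk M Y"
    using J indep_subset by (auto intro!: card_le_rk)
  ultimately show ?thesis using I J by linarith
qed

lemma rk_insert_le: "rk M (insert x X) \<le> Suc (rk M X)"
  using rk_submodular[of "{x}" X] rk_le_card[of "{x}"] by simp

text \<open>Submodularity for \<open>insert x X\<close> and \<open>Y\<close>, whose intersection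
  still contains \<open>X\<close>. This is what makes closure monotone.\<close>

lemma rk_insert_eq_mono:
  assumes "rk M (insert x X) = rk M X" "X \<subseteq> Y"
  shows "rk M (insert x Y) = rk M Y"
proof -
  have "insert x X \<union> Y = insert x Y" using assms by auto
  then have "rk M (insert x Y) + rk M (insert x X \<inter> Y) \<le> rk M (insert x X) + rk M Y"
    using rk_submodular[of "insert x X" Y] by simp
  moreover have "rk M X \<le> rk M (insert x X \<inter> Y)" using assms by (intro rk_mono) auto
  moreover have "rk M Y \<le> rk M (insert x Y)" by (intro rk_mono) auto
  ultimately show ?thesis using assms(1) by linarith
qed

lemma rk_Un_eq:
  assumes "finite Y" "\<And>y. y \<in> Y \<Longrightarrow> rk M (insert y X) = rk M X"
  shows "rk M (X \<union> Y) = rk M X"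
  using assms
proof (induction Y rule: finite_induct)
  case (insert y Y)
  have "rk M (insert y (X \<union> Y)) = rk M (X \<union> Y)"
    by (rule rk_insert_eq_mono[of y X]) (use insert.prems in auto)
  moreover have "rk M (X \<union> Y) = rk M X" using insert.IH insert.prems by simp
  ultimately show ?case by simp
qed simp

section \<open>Closure operator and flats\<close>

lemma mem_mclosure: "x \<in> mclosure M X \<longleftrightarrow> x \<in> ground M \<and> rk M (insert x X) = rk M X"
  by (simp add: mclosure_def)

lemma mclosure_subset_ground: "mclosure M X \<subseteq> ground M"
  by (auto simp: mclosure_def)

lemma subset_mclosure: "X \<subseteq> ground M \<Longrightarrow> X \<subseteq> mclosure M X"
  by (auto simp: mclosure_def insert_absorb)

lemma rk_mclosure: assumes "X \<subseteq> ground M" shows "rk M (mclosure M X) = rk M X"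
proof -
  have "rk M (X \<union> mclosure M X) = rk M X"
    by (rule rk_Un_eq)
      (use finite_subset[OF mclosure_subset_ground finite_ground] in \<open>auto simp: mclosure_def\<close>)
  then show ?thesis using subset_mclosure[OF assms] by (simp add: Un_absorb1)
qed

lemma mclosure_mono: "X \<subseteq> Y \<Longrightarrow> mclosure M X \<subseteq> mclosure M Y"
  using rk_insert_eq_mono by (fastforce simp: mclosure_def)

lemma mclosure_in_flats:
  assumes "X \<subseteq> ground M" shows "mclosure M X \<in> flats M"
proof -
  have "rk M (insert x X) = rk M X" if "rk M (insert x (mclosure M X)) = rk M (mclosure M X)" for x
  proof -
    have "rk M (insert x X) \<le> rk M (insert x (mclosure M X))"
      using subset_mclosure[OF assms] by (intro rk_mono) auto
    then show ?thesis using that rk_mclosure[OF assms] rk_mono[OF subset_insertI, of X x] by linarith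
  qed
  then have "mclosure M (mclosure M X) \<subseteq> mclosure M X" unfolding mem_mclosure subset_iff by blast
  then show ?thesis
    using subset_mclosure[OF mclosure_subset_ground] mclosure_subset_ground by (auto simp: flats_def)
qed

lemma finite_flats: "finite (flats M)"
  using finite_ground by (auto simp: flats_def intro: finite_subset[of _ "Pow (ground M)"])

lemma flats_subset_ground: "F \<in> flats M \<Longrightarrow> F \<subseteq> ground M"
  by (simp add: flats_def)

lemma ground_in_flats: "ground M \<in> flats M"
  using subset_mclosure mclosure_subset_ground by (auto simp: flats_def)

lemma mclosure_subset_flat:
  assumes "F \<in> flats M" "X \<subseteq> F" shows "mclosure M X \<subseteq> F"
  using mclosure_mono[OF assms(2)] assms(1) by (simp add: flats_def)

lemma rk_insert_flat:
  assumes "F \<in> flats M" "x \<in> ground M" "x \<notin> F"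
  shows "rk M (insert x F) = Suc (rk M F)"
proof -
  have "rk M (insert x F) \<noteq> rk M F" using assms by (auto simp: flats_def mclosure_def)
  then show ?thesis using rk_insert_le[of x F] rk_mono[OF subset_insertI, of F x] by linarith
qed

text \<open>An element of \<open>G\<close> outside the flat \<open>F\<close> would already raise the
  rank by one.\<close>

lemma flat_eqI:
  assumes "F \<in> flats M" "G \<subseteq> ground M" "F \<subseteq> G" "rk M G \<le> rk M F"
  shows "F = G"
proof (rule ccontr)
  assume "F \<noteq> G"
  then obtain x where x: "x \<in> G" "x \<notin> F" using assms by auto
  then have "rk M (insert x F) = Suc (rk M F)" using assms by (intro rk_insert_flat) auto
  moreover have "rk M (insert x F) \<le> rk M G" using x assms by (intro rk_mono) auto
  ultimately show False using assms by simp
qed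

lemma flat_rk_less:
  assumes "F \<in> flats M" "G \<in> flats M" "F \<subset> G" shows "rk M F < rk M G"
proof (rule ccontr)
  assume "\<not> ?thesis"
  then have "F = G" using assms flats_subset_ground by (intro flat_eqI) auto
  then show False using assms by simp
qed

lemma bottom_in_flats: "mclosure M {} \<in> flats M"
  by (simp add: mclosure_in_flats)

lemma bottom_subset_flat: "F \<in> flats M \<Longrightarrow> mclosure M {} \<subseteq> F"
  by (simp add: mclosure_subset_flat)

lemma rk_bottom: "rk M (mclosure M {}) = 0"
  by (simp add: rk_empty rk_mclosure)

lemma flat_rk_0: "F \<in> flats M \<Longrightarrow> rk M F = 0 \<longleftrightarrow> F = mclosure M {}"
  using flat_eqI[OF bottom_in_flats, of F] flats_subset_ground[of F] bottom_subset_flat[of F] rk_bottom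
  by auto

lemma flat_rk_mrank: "F \<in> flats M \<Longrightarrow> rk M F = mrank M \<longleftrightarrow> F = ground M"
  using flat_eqI[of F "ground M"] flats_subset_ground by (auto simp: mrank_def)

lemma rk_le_mrank: "F \<in> flats M \<Longrightarrow> rk M F \<le> mrank M"
  by (simp add: mrank_def rk_mono flats_subset_ground)

lemma flat_rk_less_mrank: "F \<in> flats M \<Longrightarrow> rk M F < mrank M \<longleftrightarrow> F \<noteq> ground M"
  using rk_le_mrank flat_rk_mrank by (metis le_neq_implies_less less_irrefl)


section \<open>Restriction and contraction\<close>

lemma mrestrict_ground: "mrestrict M (ground M) = M"
  using indep_subset_ground by (auto simp: mrestrict_def prod_eq_iff)

lemma is_matroid_mrestrict: "F \<subseteq> ground M \<Longrightarrow> is_matroid (mrestrict M F)"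
proof -
  assume F: "F \<subseteq> ground M"
  have "\<exists>x\<in>J - I. insert x I \<in> indeps M \<and> insert x I \<subseteq> F"
    if "I \<in> indeps M" "I \<subseteq> F" "J \<in> indeps M" "J \<subseteq> F" "card I < card J" for I J
    using indep_augment[OF that(1,3,5)] that by blast
  then show ?thesis
    using F indep_empty indep_subset finite_subset[OF F finite_ground]
    unfolding is_matroid_def mrestrict_def by auto
qed

lemma rk_mrestrict: "X \<subseteq> F \<Longrightarrow> rk (mrestrict M F) X = rk M X"
  unfolding rk_def mrestrict_def by (rule arg_cong[where f = Max]) auto

lemma mclosure_mrestrict:
  assumes "F \<subseteq> ground M" "X \<subseteq> F" shows "mclosure (mrestrict M F) X = mclosure M X \<inter> F"
proof -
  have "rk (mrestrict M F) (insert x X) = rk M (insert x X)" if "x \<in> F" for x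
    using that assms by (intro rk_mrestrict) auto
  then show ?thesis using assms rk_mrestrict[OF assms(2)]
    by (auto simp: mclosure_def mrestrict_def)
qed

lemma flats_mrestrict:
  assumes "F \<in> flats M" shows "flats (mrestrict M F) = {G \<in> flats M. G \<subseteq> F}"
proof -
  have "mclosure (mrestrict M F) X = mclosure M X" if "X \<subseteq> F" for X
    using mclosure_mrestrict[OF flats_subset_ground[OF assms] that]
      mclosure_subset_flat[OF assms that] by auto
  then show ?thesis using flats_subset_ground[OF assms]
    by (auto simp: flats_def mrestrict_def)
qed

text \<open>A basis of \<open>X \<union> F\<close> that extends a basis of \<open>F\<close> meets
  \<open>F\<close> in exactly \<open>rk M F\<close> elements, so its part outside \<open>F\<close>
  attains the maximum. The additive form avoids truncated subtraction.\<close>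

lemma rk_mcontract:
  assumes "F \<subseteq> ground M" "X \<subseteq> ground M - F"
  shows "rk (mcontract M F) X + rk M F = rk M (X \<union> F)"
proof -
  let ?S = "{I \<in> indeps (mcontract M F). I \<subseteq> X}"
  have fin: "finite X" using assms finite_ground by (meson finite_Diff finite_subset)
  have S: "I \<in> ?S \<longleftrightarrow> I \<subseteq> X \<and> rk M (I \<union> F) = card I + rk M F" for I
    using assms by (auto simp: mcontract_def)
  have "Max (card ` ?S) = rk M (X \<union> F) - rk M F"
  proof (rule Max_eqI)
    show "finite (card ` ?S)" using fin by (auto intro: finite_subset[of _ "Pow X"])
  next
    fix n assume "n \<in> card ` ?S"
    then obtain I where I: "I \<in> ?S" "n = card I" by blast
    then have "rk M (I \<union> F) \<le> rk M (X \<union> F)" using S by (intro rk_mono) auto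
    then show "n \<le> rk M (X \<union> F) - rk M F" using I S by auto
  next
    obtain B where B: "B \<in> indeps M" "B \<subseteq> F" "card B = rk M F" by (rule rk_attained)
    then obtain J where J: "J \<in> indeps M" "B \<subseteq> J" "J \<subseteq> X \<union> F" "card J = rk M (X \<union> F)"
      using indep_extend[of B "X \<union> F"] by blast
    have "card (J \<inter> F) \<le> rk M F" using J indep_subset by (intro card_le_rk) auto
    moreover have "card B \<le> card (J \<inter> F)" using J B indep_finite by (intro card_mono) auto
    ultimately have "card (J \<inter> F) = rk M F" using B by simp
    moreover have "card J = card (J - F) + card (J \<inter> F)"
    proof -
      have "card ((J - F) \<union> (J \<inter> F)) = card (J - F) + card (J \<inter> F)"
        using indep_finite[OF J(1)] by (intro card_Un_disjoint) auto
      then show ?thesis by (simp add: Un_Diff_Int)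
    qed
    ultimately have c: "card (J - F) + rk M F = rk M (X \<union> F)" using J by simp
    have "rk M (X \<union> F) \<le> rk M ((J - F) \<union> F)"
      using card_le_rk[OF J(1), of "(J - F) \<union> F"] J by auto
    moreover have "rk M ((J - F) \<union> F) \<le> rk M (X \<union> F)" using J by (intro rk_mono) auto
    ultimately have "J - F \<in> ?S" using c J unfolding S by auto
    moreover have "rk M (X \<union> F) - rk M F = card (J - F)" using c by simp
    ultimately show "rk M (X \<union> F) - rk M F \<in> card ` ?S" by blast
  qed
  moreover have "rk M F \<le> rk M (X \<union> F)" by (intro rk_mono) auto
  ultimately show ?thesis by (simp add: rk_def)
qed

lemma mclosure_mcontract:
  assumes "F \<subseteq> ground M" "X \<subseteq> ground M - F"
  shows "mclosure (mcontract M F) X = mclosure M (X \<union> F) - F"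
proof -
  have "rk (mcontract M F) (insert x X) = rk (mcontract M F) X \<longleftrightarrow>
      rk M (insert x (X \<union> F)) = rk M (X \<union> F)" if "x \<in> ground M - F" for x
    using rk_mcontract[OF assms] rk_mcontract[of F "insert x X"] assms that by auto
  moreover have "ground (mcontract M F) = ground M - F" by (simp add: mcontract_def)
  ultimately show ?thesis by (auto simp: mclosure_def)
qed

text \<open>The interval from \<open>F\<close> to the ground set is the lattice of flats of the
  contraction; adding \<open>F\<close> back inverts the map.\<close>

lemma bij_betw_flats_mcontract:
  assumes "F \<in> flats M"
  shows "bij_betw (\<lambda>G. G - F) {G \<in> flats M. F \<subseteq> G} (flats (mcontract M F))"
proof (rule bij_betw_byWitness[where f' = "\<lambda>X. X \<union> F"])
  have F: "F \<subseteq> ground M" using assms by (rule flats_subset_ground)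
  show "(\<lambda>G. G - F) ` {G \<in> flats M. F \<subseteq> G} \<subseteq> flats (mcontract M F)"
  proof safe
    fix G assume G: "G \<in> flats M" "F \<subseteq> G"
    then have sub: "G - F \<subseteq> ground M - F" using flats_subset_ground by auto
    moreover have "(G - F) \<union> F = G" using G by auto
    ultimately show "G - F \<in> flats (mcontract M F)"
      using mclosure_mcontract[OF F sub] G by (auto simp: flats_def mcontract_def)
  qed
  show "(\<lambda>X. X \<union> F) ` flats (mcontract M F) \<subseteq> {G \<in> flats M. F \<subseteq> G}"
  proof safe
    fix X assume X: "X \<in> flats (mcontract M F)"
    then have sub: "X \<subseteq> ground M - F" by (auto simp: flats_def mcontract_def)
    have "X = mclosure M (X \<union> F) - F"
      using X mclosure_mcontract[OF F sub] by (simp add: flats_def)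
    moreover have "X \<union> F \<subseteq> mclosure M (X \<union> F)" using sub F by (intro subset_mclosure) auto
    ultimately have "mclosure M (X \<union> F) = X \<union> F" by auto
    then show "X \<union> F \<in> flats M" using sub F by (auto simp: flats_def)
  qed
  show "\<forall>X\<in>flats (mcontract M F). X \<union> F - F = X"
    by (auto simp: flats_def mcontract_def)
qed auto

end

lemma mrank_mrestrict: "mrank (mrestrict M F) = rk M F"
  unfolding mrank_def rk_def mrestrict_def by (rule arg_cong[where f = Max]) auto

lemma mrestrict_mrestrict: "G \<subseteq> F \<Longrightarrow> mrestrict (mrestrict M F) G = mrestrict M G"
  by (auto simp: mrestrict_def)


section \<open>Moebius functions\<close>

lemma moebius_eq_0: "\<not> x \<le> y \<Longrightarrow> moebius P x y = 0"
  by (simp add: moebius.simps)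

lemma moebius_nonzeroD: "moebius P x y \<noteq> 0 \<Longrightarrow> x \<le> y"
  using moebius_eq_0 by blast

lemma moebius_refl: "finite P \<Longrightarrow> x \<in> P \<Longrightarrow> moebius P x x = 1"
  by (simp add: moebius.simps)

lemma moebius_less:
  assumes "finite P" "x \<in> P" "y \<in> P" "x < y"
  shows "moebius P x y = - (\<Sum>z\<in>{z\<in>P. x \<le> z \<and> z < y}. moebius P x z)"
  using assms by (subst moebius.simps) auto

text \<open>A Moebius value depends only on its interval. The conditions on \<open>f\<close>
  therefore concern that interval alone, so the lemma serves restrictions (\<open>f = id\<close>) as
  well as contractions (\<open>f\<close> removes a flat).\<close>

lemma moebius_order_iso:
  fixes f :: "'b::order \<Rightarrow> 'c::order"
  assumes "finite P" "finite P'" "x \<in> P" "y \<in> P" "x \<le> y"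
    and "bij_betw f {z\<in>P. x \<le> z \<and> z \<le> y} {z\<in>P'. f x \<le> z \<and> z \<le> f y}"
    and "\<And>u v. \<lbrakk>u \<in> P; v \<in> P; x \<le> u; u \<le> y; x \<le> v; v \<le> y\<rbrakk> \<Longrightarrow> f u \<le> f v \<longleftrightarrow> u \<le> v"
  shows "moebius P' (f x) (f y) = moebius P x y"
  using assms(4-)
proof (induction "card {z\<in>P. z \<le> y}" arbitrary: y rule: less_induct)
  case less
  let ?I = "{z\<in>P. x \<le> z \<and> z \<le> y}" and ?I' = "{z\<in>P'. f x \<le> z \<and> z \<le> f y}"
  have img: "f ` ?I = ?I'" and inj: "inj_on f ?I"
    using less.prems(3) by (auto simp: bij_betw_def)
  have "x \<in> ?I" "y \<in> ?I" using less.prems assms(3) by auto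
  then have fxy: "f x \<in> P'" "f y \<in> P'" "f x \<le> f y" using img by blast+
  show ?case
  proof (cases "x = y")
    case True
    then show ?thesis using fxy less.prems assms by (simp add: moebius_refl)
  next
    case False
    then have lt: "x < y" "f x < f y"
      using less.prems fxy inj \<open>x \<in> ?I\<close> \<open>y \<in> ?I\<close> by (auto simp: inj_on_eq_iff order.strict_iff_order)
    have feq: "f z = f y \<longleftrightarrow> z = y" if "z \<in> ?I" for z
      using inj that \<open>y \<in> ?I\<close> by (auto simp: inj_on_eq_iff)
    have bij': "bij_betw f {z\<in>P. x \<le> z \<and> z < y} {z\<in>P'. f x \<le> z \<and> z < f y}"
    proof (rule bij_betw_subset[OF less.prems(3)])
      have "{z\<in>P. x \<le> z \<and> z < y} = ?I - {y}" "{z\<in>P'. f x \<le> z \<and> z < f y} = ?I' - {f y}"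
        by (auto simp: order.strict_iff_order)
      then show "f ` {z\<in>P. x \<le> z \<and> z < y} = {z\<in>P'. f x \<le> z \<and> z < f y}"
        using img feq by auto
    qed auto
    have IH: "moebius P' (f x) (f z) = moebius P x z" if z: "z \<in> P" "x \<le> z" "z < y" for z
    proof (rule less.hyps)
      have "y \<in> {u\<in>P. u \<le> y} - {u\<in>P. u \<le> z}" using z less.prems by auto
      then have "{u\<in>P. u \<le> z} \<subset> {u\<in>P. u \<le> y}" using z by auto
      then show "card {u\<in>P. u \<le> z} < card {u\<in>P. u \<le> y}" using assms by (simp add: psubset_card_mono)
      have zI: "z \<in> ?I" using z by auto
      then have fz: "f z \<le> f y" using less.prems(4)[of z y] \<open>y \<in> ?I\<close> by auto
      show "bij_betw f {u\<in>P. x \<le> u \<and> u \<le> z} {u\<in>P'. f x \<le> u \<and> u \<le> f z}"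
      proof (rule bij_betw_subset[OF less.prems(3)])
        show "f ` {u\<in>P. x \<le> u \<and> u \<le> z} = {u\<in>P'. f x \<le> u \<and> u \<le> f z}" (is "?A = ?B")
        proof
          show "?A \<subseteq> ?B"
          proof safe
            fix u assume u: "u \<in> P" "x \<le> u" "u \<le> z"
            then have "u \<in> ?I" using z by auto
            then have "f u \<in> ?I'" using img by blast
            then show "f u \<in> P'" "f x \<le> f u" by auto
            show "f u \<le> f z" using less.prems(4)[of u z] zI \<open>u \<in> ?I\<close> u by auto
          qed
          show "?B \<subseteq> ?A"
          proof
            fix v assume v: "v \<in> ?B"
            then have "v \<in> ?I'" using fz by auto
            then obtain u where u: "u \<in> ?I" "v = f u" using img by blast
            then have "u \<le> z" using less.prems(4)[of u z] zI v by auto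
            then show "v \<in> ?A" using u by auto
          qed
        qed
      qed (use z in auto)
      show "f u \<le> f v \<longleftrightarrow> u \<le> v"
        if "u \<in> P" "v \<in> P" "x \<le> u" "u \<le> z" "x \<le> v" "v \<le> z" for u v
        using that z by (intro less.prems(4)) auto
    qed (use z in auto)
    have "moebius P' (f x) (f y) = - (\<Sum>z\<in>{z\<in>P'. f x \<le> z \<and> z < f y}. moebius P' (f x) z)"
      using assms(2) fxy lt by (simp add: moebius_less)
    also have "\<dots> = - (\<Sum>z\<in>{z\<in>P. x \<le> z \<and> z < y}. moebius P' (f x) (f z))"
      by (simp add: sum.reindex_bij_betw[OF bij'])
    also have "\<dots> = - (\<Sum>z\<in>{z\<in>P. x \<le> z \<and> z < y}. moebius P x z)"
      using IH by simp
    also have "\<dots> = moebius P x y" using assms less.prems lt by (simp add: moebius_less)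
    finally show ?thesis .
  qed
qed

lemma sum_moebius_le:
  assumes "finite P" "x \<in> P" "y \<in> P"
  shows "(\<Sum>z\<in>{z\<in>P. z \<le> y}. moebius P x z) = (if x = y then 1 else 0)"
proof -
  have "(\<Sum>z\<in>{z\<in>P. z \<le> y}. moebius P x z) = (\<Sum>z\<in>{z\<in>P. x \<le> z \<and> z \<le> y}. moebius P x z)"
    using assms(1) by (intro sum.mono_neutral_right) (auto dest: moebius_nonzeroD)
  also have "\<dots> = (if x = y then 1 else 0)"
  proof (cases "x \<le> y")
    case False
    then have "{z\<in>P. x \<le> z \<and> z \<le> y} = {}" by (auto dest: order_trans)
    then show ?thesis using False by (simp only: sum.empty) auto
  qed (simp add: sum_moebius assms)
  finally show ?thesis .
qed

text \<open>The Moebius function is a left inverse of the zeta function by definition. With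
  \<open>g = \<zeta>\<mu> - \<delta>\<close>, associativity gives \<open>\<mu>g = 0\<close>, and \<open>g = 0\<close> follows by induction since
  \<open>\<mu>\<close> is unitriangular.\<close>

lemma sum_moebius_ge:
  assumes "finite P" "x \<in> P" "y \<in> P"
  shows "(\<Sum>z\<in>{z\<in>P. x \<le> z}. moebius P z y) = (if x = y then 1 else 0)"
  using assms(2)
proof (induction "card {z\<in>P. x \<le> z}" arbitrary: x rule: less_induct)
  case less
  define g where "g z = (\<Sum>w\<in>{w\<in>P. z \<le> w}. moebius P w y) - (if z = y then 1 else 0)" for z
  have g0: "g z = 0" if "z \<in> P" "x < z" for z
  proof -
    have "x \<in> {u\<in>P. x \<le> u} - {u\<in>P. z \<le> u}" using that less.prems by auto
    then have "{u\<in>P. z \<le> u} \<subset> {u\<in>P. x \<le> u}" using that by auto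
    then have "card {u\<in>P. z \<le> u} < card {u\<in>P. x \<le> u}"
      using assms by (simp add: psubset_card_mono)
    from less.hyps[OF this that(1)] show ?thesis by (simp add: g_def)
  qed
  have "(\<Sum>z\<in>P. moebius P x z * (\<Sum>w\<in>{w\<in>P. z \<le> w}. moebius P w y))
      = (\<Sum>z\<in>P. \<Sum>w\<in>{w\<in>P. z \<le> w}. moebius P x z * moebius P w y)"
    by (simp add: sum_distrib_left)
  also have "\<dots> = (\<Sum>w\<in>P. \<Sum>z\<in>{z\<in>P. z \<le> w}. moebius P x z * moebius P w y)"
    using assms(1) by (intro sum.swap_restrict) auto
  also have "\<dots> = (\<Sum>w\<in>P. (if x = w then 1 else 0) * moebius P w y)"
    using assms(1) less.prems by (simp add: sum_distrib_right[symmetric] sum_moebius_le)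
  also have "\<dots> = moebius P x y"
    using assms(1) less.prems by (simp add: if_distrib[of "\<lambda>u. u * _"] cong: if_cong)
  finally have "(\<Sum>z\<in>P. moebius P x z * g z) = 0"
    using assms(1,3)
    by (simp add: g_def right_diff_distrib sum_subtractf if_distrib[of "\<lambda>u. _ * u"] cong: if_cong)
  also have "(\<Sum>z\<in>P. moebius P x z * g z) = (\<Sum>z\<in>{x}. moebius P x z * g z)"
  proof (rule sum.mono_neutral_right)
    show "\<forall>z\<in>P - {x}. moebius P x z * g z = 0"
    proof
      fix z assume z: "z \<in> P - {x}"
      show "moebius P x z * g z = 0"
        using z g0[of z] moebius_nonzeroD[of P x z] by (auto simp: order.strict_iff_order)
    qed
  qed (use assms less.prems in auto)
  finally have "g x = 0" using assms less.prems by (simp add: moebius_refl)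
  then show ?case by (simp add: g_def)
qed


section \<open>Reversal of polynomials\<close>

lemma coeff_rev_poly: "coeff (rev_poly n p) k = (if k \<le> n then coeff p (n - k) else 0)"
proof -
  have "coeff (rev_poly n p) k = (\<Sum>i\<le>n. if n - i = k then coeff p i else 0)"
    by (simp add: rev_poly_def coeff_sum coeff_monom)
  also have "\<dots> = (if k \<le> n then coeff p (n - k) else 0)"
  proof (cases "k \<le> n")
    case True
    have "(\<Sum>i\<le>n. if n - i = k then coeff p i else 0) = (\<Sum>i\<le>n. if i = n - k then coeff p i else 0)"
      by (rule sum.cong) (use True in auto)
    then show ?thesis using True by simp
  qed (auto intro!: sum.neutral)
  finally show ?thesis .
qed

lemma rev_poly_sum: "rev_poly n (\<Sum>i\<in>A. f i) = (\<Sum>i\<in>A. rev_poly n (f i))"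
  by (rule poly_eqI) (simp add: coeff_rev_poly coeff_sum)

lemma rev_poly_monom: "k \<le> n \<Longrightarrow> rev_poly n (monom c k) = monom c (n - k)"
  by (rule poly_eqI) (auto simp: coeff_rev_poly coeff_monom)

text \<open>\<open>rev_poly n\<close> discards coefficients beyond degree n, so multiplicativity
  rests on the two degree bounds.\<close>

lemma rev_poly_mult:
  fixes p q :: "'a::comm_semiring_1 poly"
  assumes "degree p \<le> m" "degree q \<le> n"
  shows "rev_poly (m + n) (p * q) = rev_poly m p * rev_poly n q"
proof -
  have "p * q = (\<Sum>i\<le>m. \<Sum>j\<le>n. monom (coeff p i * coeff q j) (i + j))"
    by (subst poly_as_sum_of_monoms'[OF assms(1), symmetric],
        subst poly_as_sum_of_monoms'[OF assms(2), symmetric])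
      (simp add: sum_product mult_monom)
  then have "rev_poly (m + n) (p * q)
      = (\<Sum>i\<le>m. \<Sum>j\<le>n. monom (coeff p i * coeff q j) (m + n - (i + j)))"
    by (simp add: rev_poly_sum rev_poly_monom add_mono)
  also have "\<dots> = (\<Sum>i\<le>m. \<Sum>j\<le>n. monom (coeff p i) (m - i) * monom (coeff q j) (n - j))"
    by (intro sum.cong refl) (simp add: mult_monom)
  also have "\<dots> = rev_poly m p * rev_poly n q"
    by (simp add: rev_poly_def sum_product)
  finally show ?thesis .
qed

lemma rev_poly_neg_one_power:
  fixes p :: "'a::comm_ring_1 poly"
  shows "rev_poly n ((-1) ^ k * p) = (-1) ^ k * rev_poly n p"
  by (rule poly_eqI) (cases "even k"; simp add: coeff_rev_poly)


section \<open>Characteristic polynomials of intervals\<close>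

text \<open>With \<open>P\<close> the flats of a matroid and \<open>\<rho>\<close> its rank, one
  function covers the characteristic polynomials of all minors on intervals, without changing the
  ground set.\<close>

definition interval_char_poly :: "'b::order set \<Rightarrow> ('b \<Rightarrow> nat) \<Rightarrow> 'b \<Rightarrow> 'b \<Rightarrow> int poly" where
  "interval_char_poly P \<rho> x y = (\<Sum>z\<in>{z\<in>P. x \<le> z \<and> z \<le> y}. monom (moebius P x z) (\<rho> y - \<rho> z))"

definition rev_interval_char_poly :: "'b::order set \<Rightarrow> ('b \<Rightarrow> nat) \<Rightarrow> 'b \<Rightarrow> 'b \<Rightarrow> int poly" where
  "rev_interval_char_poly P \<rho> x y = (\<Sum>z\<in>{z\<in>P. x \<le> z \<and> z \<le> y}. monom (moebius P x z) (\<rho> z - \<rho> x))"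

lemma rev_poly_interval_char_poly:
  assumes "mono_on P \<rho>" "x \<in> P" "y \<in> P"
  shows "rev_poly (\<rho> y - \<rho> x) (interval_char_poly P \<rho> x y) = rev_interval_char_poly P \<rho> x y"
  unfolding interval_char_poly_def rev_interval_char_poly_def rev_poly_sum
proof (rule sum.cong, rule refl)
  fix z assume z: "z \<in> {z\<in>P. x \<le> z \<and> z \<le> y}"
  then have "\<rho> x \<le> \<rho> z" "\<rho> z \<le> \<rho> y" using assms by (auto dest: mono_onD)
  then show "rev_poly (\<rho> y - \<rho> x) (monom (moebius P x z) (\<rho> y - \<rho> z))
      = monom (moebius P x z) (\<rho> z - \<rho> x)"
    by (subst rev_poly_monom) (auto intro: arg_cong2[where f = monom])
qed

lemma rev_poly_rev_interval_char_poly: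
  assumes "mono_on P \<rho>" "x \<in> P" "y \<in> P"
  shows "rev_poly (\<rho> y - \<rho> x) (rev_interval_char_poly P \<rho> x y) = interval_char_poly P \<rho> x y"
  unfolding interval_char_poly_def rev_interval_char_poly_def rev_poly_sum
proof (rule sum.cong, rule refl)
  fix z assume z: "z \<in> {z\<in>P. x \<le> z \<and> z \<le> y}"
  then have "\<rho> x \<le> \<rho> z" "\<rho> z \<le> \<rho> y" using assms by (auto dest: mono_onD)
  then show "rev_poly (\<rho> y - \<rho> x) (monom (moebius P x z) (\<rho> z - \<rho> x))
      = monom (moebius P x z) (\<rho> y - \<rho> z)"
    by (subst rev_poly_monom) (auto intro: arg_cong2[where f = monom])
qed

text \<open>In the incidence algebra the two factors are \<open>(\<mu>t\<^sup>\<rho>)\<zeta>\<close> and \<open>\<mu>(t\<^sup>\<rho>\<zeta>)\<close>, so the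
  product telescopes to \<open>(\<mu>t\<^sup>\<rho>)(t\<^sup>\<rho>\<zeta>)\<close>, the Moebius inversion formula scaled by a power of \<open>t\<close>.\<close>

lemma rev_interval_char_poly_kernel:
  assumes fin: "finite P" and mono: "mono_on P \<rho>" and x: "x \<in> P" and y: "y \<in> P"
  shows "(\<Sum>z\<in>{z\<in>P. x \<le> z \<and> z \<le> y}. rev_interval_char_poly P \<rho> x z * interval_char_poly P \<rho> z y)
    = (if x = y then 1 else 0)"
proof -
  define m where "m u = monom (moebius P x u) (\<rho> u - \<rho> x)" for u
  define n where "n z v = monom (moebius P z v) (\<rho> y - \<rho> v)" for z v
  \<comment> \<open>Only the upper bound \<open>y\<close> stays in the index set. The lower bounds
    are enforced by \<open>m\<close> and \<open>n\<close> vanishing off the order, which allows the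
    triangular sums to be exchanged.\<close>
  define Y where "Y = {v\<in>P. v \<le> y}"
  have Y: "finite Y" using fin by (simp add: Y_def)
  have m0: "m u = 0" if "\<not> x \<le> u" for u using that by (simp add: m_def moebius_eq_0)
  have n0: "n z v = 0" if "\<not> z \<le> v" for z v using that by (simp add: n_def moebius_eq_0)
  have R: "rev_interval_char_poly P \<rho> x z = (\<Sum>u\<in>{u\<in>Y. u \<le> z}. m u)" if "z \<in> Y" for z
    unfolding rev_interval_char_poly_def m_def[symmetric]
    by (rule sum.mono_neutral_left) (use fin m0 that in \<open>auto simp: Y_def\<close>)
  have X: "interval_char_poly P \<rho> z y = (\<Sum>v\<in>Y. n z v)" for z
    unfolding interval_char_poly_def n_def[symmetric]
    by (rule sum.mono_neutral_left) (use Y n0 in \<open>auto simp: Y_def\<close>)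
  have R0: "(\<Sum>u\<in>{u\<in>Y. u \<le> z}. m u) = 0" if "\<not> x \<le> z" for z
    by (rule sum.neutral) (use that m0 in \<open>auto dest: order_trans\<close>)
  have inner: "(\<Sum>z\<in>{z\<in>Y. u \<le> z}. n z v) = (if u = v then monom 1 (\<rho> y - \<rho> v) else 0)"
    if "u \<in> Y" "v \<in> Y" for u v
  proof -
    have "(\<Sum>z\<in>{z\<in>Y. u \<le> z}. n z v) = (\<Sum>z\<in>{z\<in>P. u \<le> z}. n z v)"
      by (rule sum.mono_neutral_left)
        (use fin n0 that in \<open>auto simp: Y_def dest: order_trans\<close>)
    also have "\<dots> = monom (\<Sum>z\<in>{z\<in>P. u \<le> z}. moebius P z v) (\<rho> y - \<rho> v)"
      by (simp add: n_def monom_sum)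
    also have "\<dots> = (if u = v then monom 1 (\<rho> y - \<rho> v) else 0)"
      using sum_moebius_ge[OF fin, of u v] that by (auto simp: Y_def)
    finally show ?thesis .
  qed
  have "(\<Sum>z\<in>{z\<in>P. x \<le> z \<and> z \<le> y}. rev_interval_char_poly P \<rho> x z * interval_char_poly P \<rho> z y)
      = (\<Sum>z\<in>{z\<in>P. x \<le> z \<and> z \<le> y}. (\<Sum>u\<in>{u\<in>Y. u \<le> z}. m u) * (\<Sum>v\<in>Y. n z v))"
    by (rule sum.cong) (use R X in \<open>auto simp: Y_def\<close>)
  also have "\<dots> = (\<Sum>z\<in>Y. (\<Sum>u\<in>{u\<in>Y. u \<le> z}. m u) * (\<Sum>v\<in>Y. n z v))"
    by (rule sum.mono_neutral_left) (use fin R0 in \<open>auto simp: Y_def\<close>)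
  also have "\<dots> = (\<Sum>z\<in>Y. \<Sum>u\<in>{u\<in>Y. u \<le> z}. m u * (\<Sum>v\<in>Y. n z v))"
    by (simp add: sum_distrib_right)
  also have "\<dots> = (\<Sum>u\<in>Y. \<Sum>z\<in>{z\<in>Y. u \<le> z}. m u * (\<Sum>v\<in>Y. n z v))"
    using Y by (intro sum.swap_restrict)
  also have "\<dots> = (\<Sum>u\<in>Y. m u * (\<Sum>z\<in>{z\<in>Y. u \<le> z}. \<Sum>v\<in>Y. n z v))"
    by (simp add: sum_distrib_left)
  also have "\<dots> = (\<Sum>u\<in>Y. m u * (\<Sum>v\<in>Y. \<Sum>z\<in>{z\<in>Y. u \<le> z}. n z v))"
    by (subst sum.swap) simp
  also have "\<dots> = (\<Sum>u\<in>Y. m u * monom 1 (\<rho> y - \<rho> u))"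
    by (rule sum.cong) (use Y inner in \<open>auto simp: sum.delta\<close>)
  also have "\<dots> = (\<Sum>u\<in>Y. monom (moebius P x u) (\<rho> y - \<rho> x))"
  proof (rule sum.cong, rule refl)
    fix u assume u: "u \<in> Y"
    show "m u * monom 1 (\<rho> y - \<rho> u) = monom (moebius P x u) (\<rho> y - \<rho> x)"
    proof (cases "x \<le> u")
      case True
      then have "\<rho> x \<le> \<rho> u" "\<rho> u \<le> \<rho> y" using u x y mono by (auto simp: Y_def dest: mono_onD)
      then show ?thesis by (simp add: m_def mult_monom)
    qed (simp add: m0 moebius_eq_0)
  qed
  also have "\<dots> = monom (if x = y then 1 else 0) (\<rho> y - \<rho> x)"
    using sum_moebius_le[OF fin x y] by (simp add: monom_sum[symmetric] Y_def)
  also have "\<dots> = (if x = y then 1 else 0)" by (simp add: one_pCons monom_0)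
  finally show ?thesis .
qed

lemma coeff_rev_interval_char_poly:
  assumes "finite P"
  shows "coeff (rev_interval_char_poly P \<rho> x y) k
    = (\<Sum>z\<in>{z\<in>P. x \<le> z \<and> z \<le> y \<and> \<rho> z - \<rho> x = k}. moebius P x z)"
  unfolding rev_interval_char_poly_def coeff_sum coeff_monom
  by (rule sum.mono_neutral_cong_right) (use assms in auto)

lemma degree_rev_interval_char_poly_le:
  assumes "finite P" "mono_on P \<rho>" "y \<in> P"
  shows "degree (rev_interval_char_poly P \<rho> x y) \<le> \<rho> y - \<rho> x"
proof (rule degree_le, intro allI impI)
  fix i assume "\<rho> y - \<rho> x < i"
  then have "{z\<in>P. x \<le> z \<and> z \<le> y \<and> \<rho> z - \<rho> x = i} = {}"
    using mono_onD[OF assms(2) _ assms(3)] by (fastforce dest: diff_le_mono)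
  then show "coeff (rev_interval_char_poly P \<rho> x y) i = 0"
    unfolding coeff_rev_interval_char_poly[OF assms(1)] by (simp only: sum.empty)
qed

lemma rev_interval_char_poly_refl:
  assumes "finite P" "x \<in> P" shows "rev_interval_char_poly P \<rho> x x = 1"
proof -
  have "{z\<in>P. x \<le> z \<and> z \<le> x} = {x}" using assms by auto
  then show ?thesis using assms by (simp add: rev_interval_char_poly_def moebius_refl)
qed


section \<open>Intervals in the lattice of flats\<close>

context
  fixes M :: "'a matroid"
  assumes M: "is_matroid M"
begin

lemma mono_on_rk: "mono_on S (rk M)"
  by (rule mono_onI) (rule rk_mono[OF M])

lemma moebius_flats_mrestrict:
  assumes "K \<in> flats M" "F \<in> flats M" "G \<in> flats M" "F \<subseteq> K" "G \<subseteq> K"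
  shows "flat_moebius (mrestrict M K) F G = flat_moebius M F G"
proof (cases "F \<subseteq> G")
  case True
  have fl: "flats (mrestrict M K) = {G \<in> flats M. G \<subseteq> K}"
    by (rule flats_mrestrict[OF M assms(1)])
  have eq: "{H \<in> flats (mrestrict M K). F \<subseteq> H \<and> H \<subseteq> G} = {H \<in> flats M. F \<subseteq> H \<and> H \<subseteq> G}"
    using fl assms by auto
  have "moebius (flats M) (id F) (id G) = moebius (flats (mrestrict M K)) F G"
    by (rule moebius_order_iso) (use fl finite_flats[OF M] assms True eq in \<open>auto simp: bij_betw_def\<close>)
  then show ?thesis by simp
qed (simp add: moebius_eq_0)

lemma rev_interval_char_poly_mrestrict:
  assumes "K \<in> flats M" "F \<in> flats M" "F \<subseteq> K"
  shows "rev_interval_char_poly (flats (mrestrict M K)) (rk (mrestrict M K)) F K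
    = rev_interval_char_poly (flats M) (rk M) F K"
  unfolding rev_interval_char_poly_def
proof (rule sum.cong)
  show "{z \<in> flats (mrestrict M K). F \<le> z \<and> z \<le> K} = {z \<in> flats M. F \<le> z \<and> z \<le> K}"
    using flats_mrestrict[OF M assms(1)] by auto
next
  fix z assume "z \<in> {z \<in> flats M. F \<le> z \<and> z \<le> K}"
  then show "monom (flat_moebius (mrestrict M K) F z) (rk (mrestrict M K) z - rk (mrestrict M K) F)
      = monom (flat_moebius M F z) (rk M z - rk M F)"
    using moebius_flats_mrestrict[of K F z] assms by (simp add: rk_mrestrict[OF M])
qed

lemma char_poly_mcontract:
  assumes F: "F \<in> flats M"
  shows "char_poly (mcontract M F) = interval_char_poly (flats M) (rk M) F (ground M)"
proof -
  let ?C = "mcontract M F" and ?U = "{G \<in> flats M. F \<subseteq> G}"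
  have sub: "F \<subseteq> ground M" using flats_subset_ground[OF M F] .
  have bij: "bij_betw (\<lambda>G. G - F) ?U (flats ?C)" by (rule bij_betw_flats_mcontract[OF M F])
  have fin: "finite (flats M)" "finite (flats ?C)"
    using finite_flats[OF M] bij_betw_finite[OF bij] by auto
  have rkC: "rk ?C (G - F) = rk M G - rk M F" if "G \<in> ?U" for G
  proof -
    have "G - F \<subseteq> ground M - F" "(G - F) \<union> F = G"
      using that flats_subset_ground[OF M, of G] by auto
    then show ?thesis using rk_mcontract[OF M sub, of "G - F"] by simp
  qed
  have "ground M \<in> ?U" using ground_in_flats[OF M] sub by auto
  then have mrankC: "mrank ?C = mrank M - rk M F"
    using rkC[of "ground M"] by (simp add: mrank_def mcontract_def)
  \<comment> \<open>The bottom flat is the empty set, written \<open>F - F\<close> as the image of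
    \<open>F\<close> under the bijection.\<close>
  have bot: "mclosure ?C {} = F - F"
    using mclosure_mcontract[OF M sub, of "{}"] F by (simp add: flats_def)
  have moeb: "flat_moebius ?C (F - F) (G - F) = flat_moebius M F G" if G: "G \<in> ?U" for G
  proof (rule moebius_order_iso[OF fin])
    show "bij_betw (\<lambda>G. G - F) {z \<in> flats M. F \<le> z \<and> z \<le> G}
       {z \<in> flats ?C. F - F \<le> z \<and> z \<le> G - F}"
    proof (rule bij_betw_subset[OF bij])
      show "(\<lambda>G. G - F) ` {z \<in> flats M. F \<le> z \<and> z \<le> G}
          = {z \<in> flats ?C. F - F \<le> z \<and> z \<le> G - F}" (is "?A = ?B")
      proof
        show "?A \<subseteq> ?B" using bij by (auto simp: bij_betw_def)
        show "?B \<subseteq> ?A"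
        proof
          fix v assume v: "v \<in> ?B"
          then have "v \<in> (\<lambda>G. G - F) ` ?U" using bij by (simp add: bij_betw_def)
          then obtain u where u: "u \<in> ?U" "v = u - F" by auto
          then have "u \<subseteq> G" using v G by auto
          then show "v \<in> ?A" using u by auto
        qed
      qed
    qed auto
  qed (use F G in auto)
  have "char_poly ?C = (\<Sum>G\<in>?U. monom (flat_moebius ?C (F - F) (G - F)) (mrank ?C - rk ?C (G - F)))"
    unfolding char_poly_def bot by (rule sum.reindex_bij_betw[OF bij, symmetric])
  also have "\<dots> = (\<Sum>G\<in>?U. monom (flat_moebius M F G) (mrank M - rk M G))"
  proof (rule sum.cong, rule refl)
    fix G assume G: "G \<in> ?U"
    then have "rk M F \<le> rk M G" using rk_mono[OF M] by auto
    then show "monom (flat_moebius ?C (F - F) (G - F)) (mrank ?C - rk ?C (G - F))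
        = monom (flat_moebius M F G) (mrank M - rk M G)"
      using rkC[OF G] moeb[OF G] mrankC by simp
  qed
  also have "\<dots> = interval_char_poly (flats M) (rk M) F (ground M)"
    unfolding interval_char_poly_def mrank_def
    by (rule sum.cong) (use flats_subset_ground[OF M] in auto)
  finally show ?thesis .
qed

lemma rev_poly_char_poly_mcontract:
  assumes "F \<in> flats M"
  shows "rev_poly (mrank M - rk M F) (char_poly (mcontract M F))
    = rev_interval_char_poly (flats M) (rk M) F (ground M)"
  unfolding char_poly_mcontract[OF assms] mrank_def
  by (rule rev_poly_interval_char_poly) (use mono_on_rk assms ground_in_flats[OF M] in auto)


section \<open>Signs of the Moebius function\<close>

text \<open>Weisner's theorem for the atom spanned by \<open>e\<close>: splitting the vanishing sum of \<open>\<mu>(F,X)\<close>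
  over \<open>X \<subseteq> G\<close> by the value of the join of \<open>X\<close> and \<open>e\<close> leaves, inductively, only the value \<open>G\<close>.\<close>

lemma sum_moebius_join_eq_0:
  assumes F: "F \<in> flats M" and e: "e \<notin> F" and G: "G \<in> flats M" "F \<subseteq> G" "e \<in> G"
  shows "(\<Sum>X\<in>{X\<in>flats M. F \<subseteq> X \<and> mclosure M (insert e X) = G}. flat_moebius M F X) = 0"
  using G
proof (induction "rk M G" arbitrary: G rule: less_induct)
  case less
  let ?N = "\<lambda>Y. \<Sum>X\<in>{X\<in>flats M. F \<subseteq> X \<and> mclosure M (insert e X) = Y}. flat_moebius M F X"
  let ?X = "{X\<in>flats M. F \<subseteq> X \<and> X \<subseteq> G}" and ?Y = "{Y\<in>flats M. F \<subseteq> Y \<and> e \<in> Y \<and> Y \<subseteq> G}"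
  have eG: "e \<in> ground M" using flats_subset_ground[OF M less.prems(1)] less.prems by auto
  have join: "insert e X \<subseteq> mclosure M (insert e X)" "mclosure M (insert e X) \<in> flats M"
    if "X \<in> flats M" for X
    using flats_subset_ground[OF M that] eG
    by (intro subset_mclosure[OF M] mclosure_in_flats[OF M]; auto)+
  \<comment> \<open>The element \<open>e\<close> separates \<open>F\<close> from \<open>G\<close>,
    so the sum over the interval vanishes.\<close>
  have "0 = (\<Sum>X\<in>?X. flat_moebius M F X)"
    using sum_moebius[OF finite_flats[OF M] F less.prems(1,2)] e less.prems(3) by auto
  also have "\<dots> = (\<Sum>Y\<in>?Y. \<Sum>X\<in>{X\<in>?X. mclosure M (insert e X) = Y}. flat_moebius M F X)"
  proof (rule sum.group[symmetric])
    show "(\<lambda>X. mclosure M (insert e X)) ` ?X \<subseteq> ?Y"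
    proof
      fix Y assume "Y \<in> (\<lambda>X. mclosure M (insert e X)) ` ?X"
      then obtain X where X: "X \<in> ?X" "Y = mclosure M (insert e X)" by auto
      then have "Y \<subseteq> G" using mclosure_subset_flat[OF M less.prems(1), of "insert e X"] less.prems by auto
      then show "Y \<in> ?Y" using X join[of X] by auto
    qed
  qed (use finite_flats[OF M] in auto)
  also have "\<dots> = (\<Sum>Y\<in>?Y. ?N Y)"
  proof (rule sum.cong, rule refl)
    fix Y assume Y: "Y \<in> ?Y"
    have "{X\<in>?X. mclosure M (insert e X) = Y} = {X\<in>flats M. F \<subseteq> X \<and> mclosure M (insert e X) = Y}"
      using Y join(1) by blast
    then show "(\<Sum>X\<in>{X\<in>?X. mclosure M (insert e X) = Y}. flat_moebius M F X) = ?N Y"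
      by (simp only:)
  qed
  also have "\<dots> = (\<Sum>Y\<in>{G}. ?N Y)"
  proof (rule sum.mono_neutral_right)
    show "\<forall>Y\<in>?Y - {G}. ?N Y = 0"
    proof
      fix Y assume Y: "Y \<in> ?Y - {G}"
      then have "rk M Y < rk M G" using less.prems by (intro flat_rk_less[OF M]) auto
      then show "?N Y = 0" using Y by (intro less.hyps) auto
    qed
  qed (use finite_flats[OF M] less.prems in auto)
  finally show ?case by simp
qed

text \<open>For \<open>e\<close> in \<open>G\<close> outside \<open>F\<close>, Weisner's theorem
  writes the value at \<open>G\<close> as minus the sum over flats \<open>X \<noteq> G\<close> whose
  join with \<open>e\<close> is \<open>G\<close>. Each such \<open>X\<close> has rank one less than
  \<open>G\<close>, so by induction all terms agree in sign. The exponent is a sum of ranks, of the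
  same parity as the difference.\<close>

lemma moebius_sign:
  assumes F: "F \<in> flats M" and G: "G \<in> flats M"
  shows "0 \<le> (-1) ^ (rk M G + rk M F) * flat_moebius M F G"
  using G
proof (induction "rk M G" arbitrary: G rule: less_induct)
  case less
  consider "\<not> F \<subseteq> G" | "F = G" | e where "F \<subseteq> G" "e \<in> G" "e \<notin> F" by blast
  then show ?case
  proof cases
    case 1
    then show ?thesis by (simp add: moebius_eq_0)
  next
    case 2
    then show ?thesis using F finite_flats[OF M] by (simp add: moebius_refl mult_2[symmetric])
  next
    case 3
    let ?X = "{X\<in>flats M. F \<subseteq> X \<and> mclosure M (insert e X) = G}"
    have eG: "e \<in> ground M" using flats_subset_ground[OF M less.prems] 3 by auto
    have fin: "finite ?X" using finite_flats[OF M] by auto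
    have GX: "G \<in> ?X" using 3 less.prems by (auto simp: insert_absorb flats_def)
    have "0 = (\<Sum>X\<in>?X. flat_moebius M F X)"
      using sum_moebius_join_eq_0[OF F _ less.prems] 3 by simp
    also have "\<dots> = flat_moebius M F G + (\<Sum>X\<in>?X - {G}. flat_moebius M F X)"
      by (rule sum.remove[OF fin GX])
    finally have "(-1) ^ (rk M G + rk M F) * flat_moebius M F G
        = (\<Sum>X\<in>?X - {G}. - ((-1) ^ (rk M G + rk M F) * flat_moebius M F X))"
      by (simp add: sum_negf sum_distrib_left[symmetric] eq_neg_iff_add_eq_0 flip: distrib_left)
    also have "\<dots> \<ge> 0"
    proof (rule sum_nonneg)
      fix X assume X: "X \<in> ?X - {G}"
      \<comment> \<open>Otherwise \<open>X\<close> would equal its own join with \<open>e\<close>,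
        which is \<open>G\<close>.\<close>
      have eX: "e \<notin> X"
        using X by (auto simp: insert_absorb flats_def)
      have "insert e X \<subseteq> ground M" using X eG flats_subset_ground[OF M] by auto
      from rk_mclosure[OF M this] have "rk M G = Suc (rk M X)"
        using X rk_insert_flat[OF M _ eG eX] by auto
      then show "0 \<le> - ((-1) ^ (rk M G + rk M F) * flat_moebius M F X)"
        using less.hyps[of X] X by simp
    qed
    finally show ?thesis .
  qed
qed

end


section \<open>The inverse Kazhdan--Lusztig family\<close>

text \<open>The defining sum for \<open>Q\<^sub>M\<close> without its term \<open>F = E\<close>, which is \<open>\<plusminus>Q\<^sub>M\<close>. The index set is
  written with ranks so that recursion on the rank is evident for arbitrary pairs \<open>M\<close>.\<close>

definition KL_remainder :: "('a matroid \<Rightarrow> int poly) \<Rightarrow> 'a matroid \<Rightarrow> int poly" where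
  "KL_remainder Q M = (\<Sum>F\<in>{F\<in>flats M. rk M F < mrank M}. (-1) ^ rk M F * Q (mrestrict M F)
     * rev_interval_char_poly (flats M) (rk M) F (ground M))"

text \<open>Shows the function package that recursive calls occur only at restrictions to flats of
  smaller rank.\<close>

lemma KL_remainder_cong [fundef_cong]:
  assumes "M = N" "\<And>F. F \<in> flats N \<Longrightarrow> rk N F < mrank N \<Longrightarrow> Q (mrestrict N F) = Q' (mrestrict N F)"
  shows "KL_remainder Q M = KL_remainder Q' N"
  unfolding KL_remainder_def assms(1) by (rule sum.cong) (use assms(2) in auto)

lemma sum_flats_eq_KL_remainder:
  assumes M: "is_matroid M"
  shows "(\<Sum>F\<in>flats M. (-1) ^ rk M F * Q (mrestrict M F)
        * rev_interval_char_poly (flats M) (rk M) F (ground M))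
    = KL_remainder Q M + (-1) ^ mrank M * Q M" (is "sum ?f _ = _")
proof -
  have "{F\<in>flats M. rk M F < mrank M} = flats M - {ground M}"
    using flat_rk_less_mrank[OF M] by auto
  then have "KL_remainder Q M = (\<Sum>F\<in>flats M - {ground M}. ?f F)"
    by (simp add: KL_remainder_def)
  moreover have "sum ?f (flats M) = ?f (ground M) + (\<Sum>F\<in>flats M - {ground M}. ?f F)"
    by (rule sum.remove[OF finite_flats[OF M] ground_in_flats[OF M]])
  moreover have "?f (ground M) = (-1) ^ mrank M * Q M"
    using rev_interval_char_poly_refl[OF finite_flats[OF M] ground_in_flats[OF M]]
    by (simp add: mrestrict_ground[OF M] mrank_def)
  ultimately show ?thesis by simp
qed

lemma KL_sum_eq:
  assumes M: "is_matroid M"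
  shows "(\<Sum>F\<in>flats M. (-1) ^ rk M F * Q (mrestrict M F)
        * rev_poly (mrank M - rk M F) (char_poly (mcontract M F)))
    = KL_remainder Q M + (-1) ^ mrank M * Q M"
  unfolding sum_flats_eq_KL_remainder[OF M, symmetric]
  using rev_poly_char_poly_mcontract[OF M] by (intro sum.cong refl) simp

lemma inverse_KL_family_iff:
  "inverse_KL_family Q \<longleftrightarrow> (\<forall>M. is_matroid M \<longrightarrow>
     (mrank M = 0 \<longrightarrow> Q M = 1) \<and> (mrank M > 0 \<longrightarrow> 2 * degree (Q M) < mrank M) \<and>
     (-1) ^ mrank M * rev_poly (mrank M) (Q M) = KL_remainder Q M + (-1) ^ mrank M * Q M)"
  unfolding inverse_KL_family_def by (simp add: KL_sum_eq cong: conj_cong imp_cong)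

text \<open>For \<open>r > 0\<close> the polynomials \<open>Q\<^sub>M\<close> and \<open>t\<^sup>rQ\<^sub>M(1/t)\<close> have disjoint supports, so the
  coefficients of \<open>Q\<^sub>M\<close> can be read off the remainder.\<close>

function KL_rec :: "'a matroid \<Rightarrow> int poly" where
  "KL_rec M = (if mrank M = 0 then 1 else
     (\<Sum>i<(mrank M + 1) div 2. monom (- ((-1) ^ mrank M * coeff (KL_remainder KL_rec M) i)) i))"
  by pat_completeness auto
termination
  by (relation "measure mrank") (auto simp: mrank_mrestrict)

declare KL_rec.simps [simp del]

lemma KL_rec_rank_0: "mrank M = 0 \<Longrightarrow> KL_rec M = 1"
  by (simp add: KL_rec.simps)

lemma coeff_neg_one_power_mult:
  fixes p :: "'a::comm_ring_1 poly"
  shows "coeff ((-1) ^ k * p) i = (-1) ^ k * coeff p i"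
  by (cases "even k") simp_all

lemma neg_one_power_cancel: "(-1) ^ k * ((-1) ^ k * c) = (c :: 'a::ring_1)"
  by (cases "even k") simp_all

text \<open>In degrees below r/2 the reversed polynomial contributes nothing, so the equation reads
  0 = \<open>coeff (KL_remainder KL_rec M) i\<close> plus the signed coefficient sought.\<close>

lemma coeff_KL_rec:
  assumes "mrank M > 0"
  shows "coeff (KL_rec M) i =
    (if 2 * i < mrank M then - ((-1) ^ mrank M * coeff (KL_remainder KL_rec M) i) else 0)"
proof -
  \<comment> \<open>The summation bound in \<open>KL_rec\<close> is r/2 rounded up, the number of
    admissible degrees.\<close>
  have "i < (mrank M + 1) div 2 \<longleftrightarrow> 2 * i < mrank M" by presburger
  then show ?thesis using assms
    by (subst KL_rec.simps) (simp add: coeff_sum coeff_monom del: neg_less_iff_less)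
qed

lemma degree_KL_rec: assumes "mrank M > 0" shows "2 * degree (KL_rec M) < mrank M"
proof (cases "KL_rec M = 0")
  case False
  then have "coeff (KL_rec M) (degree (KL_rec M)) \<noteq> 0" by simp
  then show ?thesis using coeff_KL_rec[OF assms] by metis
qed (use assms in simp)

lemma degree_KL_rec_le: "degree (KL_rec M) \<le> mrank M"
  using degree_KL_rec[of M] by (cases "mrank M = 0") (auto simp: KL_rec_rank_0)

text \<open>The symmetry that makes the recursion consistent: expanding \<open>t\<^bsup>rk F\<^esup>Q(1/t)\<close> for the proper
  restrictions and exchanging the sums leaves the kernel identity with its top term missing.\<close>

lemma rev_poly_KL_remainder:
  assumes M: "is_matroid M"
    and IH: "\<And>F. F \<in> flats M \<Longrightarrow> rk M F < mrank M \<Longrightarrow>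
      (-1) ^ rk M F * rev_poly (rk M F) (Q (mrestrict M F))
        = KL_remainder Q (mrestrict M F) + (-1) ^ rk M F * Q (mrestrict M F)"
    and deg: "\<And>F. F \<in> flats M \<Longrightarrow> rk M F < mrank M \<Longrightarrow> degree (Q (mrestrict M F)) \<le> rk M F"
  shows "rev_poly (mrank M) (KL_remainder Q M) = - KL_remainder Q M"
proof -
  let ?E = "ground M"
  let ?X = "interval_char_poly (flats M) (rk M)" and ?R = "rev_interval_char_poly (flats M) (rk M)"
  let ?P = "{F\<in>flats M. rk M F < mrank M}"
  let ?q = "\<lambda>F. (-1) ^ rk M F * Q (mrestrict M F)"
  have P: "?P = flats M - {?E}" using flat_rk_less_mrank[OF M] by auto
  have fin: "finite (flats M)" by (rule finite_flats[OF M])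
  have mono: "mono_on (flats M) (rk M)" by (rule mono_on_rk[OF M])
  have E: "?E \<in> flats M" by (rule ground_in_flats[OF M])
  \<comment> \<open>The equation for the restriction to \<open>F\<close>, as a sum over flats of
    \<open>M\<close>: its top term \<open>G = F\<close> has \<open>?R F F = 1\<close> and yields the
    summand outside the remainder.\<close>
  have step: "(-1) ^ rk M F * rev_poly (rk M F) (Q (mrestrict M F))
      = (\<Sum>G\<in>{G\<in>?P. G \<subseteq> F}. ?q G * ?R G F)" if F: "F \<in> ?P" for F
  proof -
    have FM: "F \<in> flats M" "F \<subseteq> ground M" using F flats_subset_ground[OF M] by auto
    have N: "is_matroid (mrestrict M F)" using FM is_matroid_mrestrict[OF M] by auto
    have fl: "flats (mrestrict M F) = {G \<in> flats M. G \<subseteq> F}" by (rule flats_mrestrict[OF M FM(1)])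
    have "{G\<in>?P. G \<subseteq> F} = insert F {G\<in>flats M. G \<subseteq> F \<and> rk M G < rk M F}"
      using F flat_rk_less[OF M _ FM(1)] by fastforce
    then have "(\<Sum>G\<in>{G\<in>?P. G \<subseteq> F}. ?q G * ?R G F)
        = ?q F * ?R F F + (\<Sum>G\<in>{G\<in>flats M. G \<subseteq> F \<and> rk M G < rk M F}. ?q G * ?R G F)"
      using fin by simp
    also have "?q F * ?R F F = (-1) ^ rk M F * Q (mrestrict M F)"
      using rev_interval_char_poly_refl[OF fin FM(1)] by simp
    also have "(\<Sum>G\<in>{G\<in>flats M. G \<subseteq> F \<and> rk M G < rk M F}. ?q G * ?R G F)
        = KL_remainder Q (mrestrict M F)"
      unfolding KL_remainder_def
    proof (rule sum.cong)
      show "{G\<in>flats M. G \<subseteq> F \<and> rk M G < rk M F}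
          = {G \<in> flats (mrestrict M F). rk (mrestrict M F) G < mrank (mrestrict M F)}"
        using fl by (auto simp: mrank_mrestrict rk_mrestrict[OF M])
    next
      fix G assume "G \<in> {G \<in> flats (mrestrict M F). rk (mrestrict M F) G < mrank (mrestrict M F)}"
      then have G: "G \<in> flats M" "G \<subseteq> F" using fl by auto
      have g: "ground (mrestrict M F) = F" by (simp add: mrestrict_def)
      show "?q G * ?R G F = (-1) ^ rk (mrestrict M F) G * Q (mrestrict (mrestrict M F) G)
          * rev_interval_char_poly (flats (mrestrict M F)) (rk (mrestrict M F)) G (ground (mrestrict M F))"
        unfolding g rev_interval_char_poly_mrestrict[OF M FM(1) G] using G
        by (simp add: mrestrict_mrestrict rk_mrestrict[OF M])
    qed
    finally show ?thesis using IH[of F] F by simp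
  qed
  \<comment> \<open>As \<open>G \<noteq> ?E\<close>, the full kernel sum is zero; the omitted term
    \<open>F = ?E\<close> equals \<open>?R G ?E\<close>.\<close>
  have kernel: "(\<Sum>F\<in>{F\<in>?P. G \<subseteq> F}. ?R G F * ?X F ?E) = - ?R G ?E" if G: "G \<in> ?P" for G
  proof -
    have "{F\<in>flats M. G \<le> F \<and> F \<le> ?E} = insert ?E {F\<in>?P. G \<subseteq> F}"
      using P G E flats_subset_ground[OF M] by auto
    moreover have "?E \<notin> {F\<in>?P. G \<subseteq> F}" using P by simp
    moreover have "?X ?E ?E = 1"
    proof -
      have "{z \<in> flats M. ?E \<subseteq> z \<and> z \<subseteq> ?E} = {?E}" using E by auto
      then show ?thesis using fin E by (simp add: interval_char_poly_def moebius_refl)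
    qed
    moreover have "G \<noteq> ?E" using G P by auto
    ultimately show ?thesis
      using rev_interval_char_poly_kernel[OF fin mono _ E, of G] G fin by (simp add: eq_neg_iff_add_eq_0 add.commute)
  qed
  have "rev_poly (mrank M) (KL_remainder Q M) = (\<Sum>F\<in>?P. rev_poly (mrank M) (?q F * ?R F ?E))"
    by (simp add: KL_remainder_def rev_poly_sum)
  also have "\<dots> = (\<Sum>F\<in>?P. ((-1) ^ rk M F * rev_poly (rk M F) (Q (mrestrict M F))) * ?X F ?E)"
  proof (rule sum.cong, rule refl)
    fix F assume F: "F \<in> ?P"
    have r: "mrank M = rk M F + (rk M ?E - rk M F)" using F by (simp add: mrank_def)
    have "rev_poly (mrank M) (Q (mrestrict M F) * ?R F ?E)
        = rev_poly (rk M F) (Q (mrestrict M F)) * rev_poly (rk M ?E - rk M F) (?R F ?E)"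
      by (subst r, rule rev_poly_mult)
        (use F deg degree_rev_interval_char_poly_le[OF fin mono E] in auto)
    also have "rev_poly (rk M ?E - rk M F) (?R F ?E) = ?X F ?E"
      by (rule rev_poly_rev_interval_char_poly[OF mono _ E]) (use F in auto)
    finally show "rev_poly (mrank M) (?q F * ?R F ?E)
        = ((-1) ^ rk M F * rev_poly (rk M F) (Q (mrestrict M F))) * ?X F ?E"
      by (simp add: mult.assoc rev_poly_neg_one_power)
  qed
  also have "\<dots> = (\<Sum>F\<in>?P. \<Sum>G\<in>{G\<in>?P. G \<subseteq> F}. ?q G * (?R G F * ?X F ?E))"
    by (rule sum.cong) (use step in \<open>auto simp: sum_distrib_right mult.assoc\<close>)
  also have "\<dots> = (\<Sum>G\<in>?P. \<Sum>F\<in>{F\<in>?P. G \<subseteq> F}. ?q G * (?R G F * ?X F ?E))"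
    by (rule sum.swap_restrict) (use fin in auto)
  also have "\<dots> = (\<Sum>G\<in>?P. ?q G * - ?R G ?E)"
    by (rule sum.cong) (use kernel in \<open>auto simp: sum_distrib_left[symmetric]\<close>)
  also have "\<dots> = - KL_remainder Q M"
    by (simp add: KL_remainder_def sum_negf)
  finally show ?thesis .
qed

lemma KL_rec_equation:
  assumes "is_matroid M"
  shows "(-1) ^ mrank M * rev_poly (mrank M) (KL_rec M)
    = KL_remainder KL_rec M + (-1) ^ mrank M * KL_rec M"
  using assms
proof (induction "mrank M" arbitrary: M rule: less_induct)
  case less
  note M = less.prems
  show ?case
  proof (cases "mrank M = 0")
    case True
    then have "KL_remainder KL_rec M = 0" by (simp add: KL_remainder_def)
    moreover have "rev_poly 0 (1 :: int poly) = 1" by (simp add: rev_poly_def monom_0)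
    ultimately show ?thesis using True by (simp add: KL_rec_rank_0)
  next
    case False
    then have r: "mrank M > 0" by simp
    let ?S = "KL_remainder KL_rec M"
    have "rev_poly (mrank M) ?S = - ?S"
    proof (rule rev_poly_KL_remainder[OF M])
      fix F assume F: "F \<in> flats M" "rk M F < mrank M"
      then have "is_matroid (mrestrict M F)"
        using is_matroid_mrestrict[OF M] flats_subset_ground[OF M] by blast
      then show "(-1) ^ rk M F * rev_poly (rk M F) (KL_rec (mrestrict M F))
        = KL_remainder KL_rec (mrestrict M F) + (-1) ^ rk M F * KL_rec (mrestrict M F)"
        using less.hyps[of "mrestrict M F"] F by (simp add: mrank_mrestrict)
      show "degree (KL_rec (mrestrict M F)) \<le> rk M F"
        using degree_KL_rec_le[of "mrestrict M F"] by (simp add: mrank_mrestrict)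
    qed
    then have anti: "(if i \<le> mrank M then coeff ?S (mrank M - i) else 0) = - coeff ?S i" for i
      by (metis coeff_rev_poly coeff_minus)
    show ?thesis
    proof (rule poly_eqI)
      fix i
      \<comment> \<open>The middle degree of an even rank: here antisymmetry says that the
        coefficient is its own negative.\<close>
      have "mrank M - i = i" if "i \<le> mrank M" "\<not> 2 * i < mrank M" "\<not> 2 * (mrank M - i) < mrank M"
        using that by linarith
      then show "coeff ((-1) ^ mrank M * rev_poly (mrank M) (KL_rec M)) i
          = coeff (?S + (-1) ^ mrank M * KL_rec M) i"
        using anti[of i]
        by (auto simp: coeff_neg_one_power_mult coeff_rev_poly coeff_KL_rec[OF r] neg_one_power_cancel split: if_splits)
    qed
  qed
qed

lemma inverse_KL_family_KL_rec: "inverse_KL_family KL_rec"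
  unfolding inverse_KL_family_iff using KL_rec_equation degree_KL_rec by (auto simp: KL_rec_rank_0)

lemma inverse_KL_family_unique:
  assumes "inverse_KL_family Q" "is_matroid M" shows "Q M = KL_rec M"
  using assms(2)
proof (induction M rule: KL_rec.induct)
  case (1 M)
  have Q: "mrank M = 0 \<Longrightarrow> Q M = 1" "mrank M > 0 \<Longrightarrow> 2 * degree (Q M) < mrank M"
    "(-1) ^ mrank M * rev_poly (mrank M) (Q M) = KL_remainder Q M + (-1) ^ mrank M * Q M"
    using assms(1) 1(2) unfolding inverse_KL_family_iff by blast+
  show ?case
  proof (cases "mrank M = 0")
    case False
    \<comment> \<open>The induction rule states its hypothesis per summand index; any index serves,
      since the remainder does not depend on it.\<close>
    then have zero: "0 \<in> {..<(mrank M + 1) div 2}" by auto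
    have S: "KL_remainder Q M = KL_remainder KL_rec M"
    proof (rule KL_remainder_cong[OF refl])
      fix F assume F: "F \<in> flats M" "rk M F < mrank M"
      then have "is_matroid (mrestrict M F)"
        using is_matroid_mrestrict[OF 1(2)] flats_subset_ground[OF 1(2)] by blast
      then show "Q (mrestrict M F) = KL_rec (mrestrict M F)" using 1(1) zero False F by blast
    qed
    have "coeff (Q M) i = coeff (KL_rec M) i" for i
    proof (cases "2 * i < mrank M")
      case True
      then have "coeff (rev_poly (mrank M) (Q M)) i = 0"
        using Q(2) False by (auto simp: coeff_rev_poly intro!: coeff_eq_0)
      then have "coeff (KL_remainder KL_rec M) i = - ((-1) ^ mrank M * coeff (Q M) i)"
        using arg_cong[OF Q(3), of "\<lambda>p. coeff p i"] S by (simp add: coeff_neg_one_power_mult)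
      then show ?thesis using True False by (simp add: coeff_KL_rec neg_one_power_cancel)
    next
      case False': False
      then have "coeff (Q M) i = 0" using Q(2) False by (intro coeff_eq_0) auto
      then show ?thesis using False False' by (simp add: coeff_KL_rec)
    qed
    then show ?thesis by (rule poly_eqI)
  qed (use Q(1) in \<open>simp add: KL_rec_rank_0\<close>)
qed

lemma inverse_KL_eq: "is_matroid M \<Longrightarrow> inverse_KL M = KL_rec M"
  unfolding inverse_KL_def
  by (rule the_equality) (auto intro: inverse_KL_family_KL_rec inverse_KL_family_unique)


section \<open>The linear coefficient\<close>

text \<open>Pairs of incomparable flats contribute zero, which brings the coefficient into the shape
  of the inner sum of \<open>whitney1\<close>.\<close>

lemma coeff_rev_interval_char_poly_ground:
  assumes M: "is_matroid M" and F: "F \<in> flats M"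
  shows "coeff (rev_interval_char_poly (flats M) (rk M) F (ground M)) k
    = (\<Sum>G\<in>{G\<in>flats M. rk M G = rk M F + k}. flat_moebius M F G)"
  unfolding coeff_rev_interval_char_poly[OF finite_flats[OF M]]
proof (rule sum.mono_neutral_left)
  show "{G \<in> flats M. F \<le> G \<and> G \<le> ground M \<and> rk M G - rk M F = k}
      \<subseteq> {G \<in> flats M. rk M G = rk M F + k}"
    using rk_mono[OF M] by fastforce
qed (use finite_flats[OF M] flats_subset_ground[OF M] in \<open>auto dest: moebius_nonzeroD\<close>)

text \<open>The degree bound leaves a constant. Only the bottom flat enters the remainder, with
  constant term 1, and the two signs cancel.\<close>

lemma KL_rec_rank_1:
  assumes M: "is_matroid M" and r: "mrank M = 1" shows "KL_rec M = 1"
proof -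
  let ?b = "mclosure M {}"
  have b: "{F\<in>flats M. rk M F = 0} = {?b}"
    using flat_rk_0[OF M] bottom_in_flats[OF M] by auto
  then have flats: "{F\<in>flats M. rk M F < mrank M} = {?b}" using r by simp
  have "KL_rec (mrestrict M ?b) = 1"
    by (rule KL_rec_rank_0) (simp add: mrank_mrestrict rk_bottom[OF M])
  then have "coeff (KL_remainder KL_rec M) 0 = 1"
    using coeff_rev_interval_char_poly_ground[OF M bottom_in_flats[OF M], of 0]
    by (simp add: KL_remainder_def flats rk_bottom[OF M] b moebius_refl finite_flats[OF M]
        bottom_in_flats[OF M])
  then show ?thesis
    by (intro poly_eqI) (simp add: coeff_KL_rec r)
qed

text \<open>Compare coefficients of \<open>t\<^bsup>r-1\<^esup>\<close>: since \<open>deg Q < rk F / 2\<close> for the restriction to a flat \<open>F\<close>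
  of positive rank, only flats of rank at most one contribute.\<close>

lemma coeff_1_KL_rec:
  assumes M: "is_matroid M" and r: "mrank M > 0"
  shows "(-1) ^ mrank M * coeff (KL_rec M) 1
    = whitney1 M 0 (int (mrank M) - 1) - whitney1 M 1 (int (mrank M))"
proof -
  let ?r = "mrank M"
  let ?R = "\<lambda>F. rev_interval_char_poly (flats M) (rk M) F (ground M)"
  define c where "c F = coeff ((-1) ^ rk M F * KL_rec (mrestrict M F) * ?R F) (?r - 1)" for F
  have fin: "finite (flats M)" by (rule finite_flats[OF M])
  have c_eq: "c F = (-1) ^ rk M F * (\<Sum>G\<in>{G\<in>flats M. rk M G = rk M F + (?r - 1)}. flat_moebius M F G)"
    if F: "F \<in> flats M" "rk M F \<le> 1" for F
  proof -
    have "is_matroid (mrestrict M F)"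
      using is_matroid_mrestrict[OF M flats_subset_ground[OF M F(1)]] .
    then have "KL_rec (mrestrict M F) = 1"
      using KL_rec_rank_0[of "mrestrict M F"] KL_rec_rank_1[of "mrestrict M F"] F(2)
      unfolding mrank_mrestrict by linarith
    then show ?thesis
      unfolding c_def using coeff_rev_interval_char_poly_ground[OF M F(1)]
      by (simp add: coeff_neg_one_power_mult)
  qed
  \<comment> \<open>With k = \<open>rk M F\<close> at least 2 and d the degree of the first factor,
    2d < k gives d < k - 1, hence d + (r - k) < r - 1.\<close>
  have c_0: "c F = 0" if F: "F \<in> flats M" "rk M F > 1" for F
  proof -
    have "2 * degree (KL_rec (mrestrict M F)) < rk M F"
      using degree_KL_rec[of "mrestrict M F"] F(2) by (simp add: mrank_mrestrict)
    moreover have "degree (?R F) \<le> ?r - rk M F"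
      unfolding mrank_def by (rule degree_rev_interval_char_poly_le[OF fin mono_on_rk[OF M] ground_in_flats[OF M]])
    moreover have "rk M F \<le> ?r" by (rule rk_le_mrank[OF M F(1)])
    ultimately have "degree (KL_rec (mrestrict M F) * ?R F) < ?r - 1"
      using F(2) degree_mult_le[of "KL_rec (mrestrict M F)" "?R F"] by linarith
    then show ?thesis by (simp add: c_def mult.assoc coeff_neg_one_power_mult coeff_eq_0)
  qed
  have "(-1) ^ ?r * rev_poly ?r (KL_rec M)
      = (\<Sum>F\<in>flats M. (-1) ^ rk M F * KL_rec (mrestrict M F) * ?R F)"
    unfolding sum_flats_eq_KL_remainder[OF M] by (rule KL_rec_equation[OF M])
  from arg_cong[OF this, of "\<lambda>p. coeff p (?r - 1)"]
  have "(-1) ^ ?r * coeff (KL_rec M) 1 = (\<Sum>F\<in>flats M. c F)"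
    using r by (simp add: coeff_neg_one_power_mult coeff_rev_poly coeff_sum c_def)
  also have "\<dots> = (\<Sum>F\<in>{F\<in>flats M. rk M F = 0} \<union> {F\<in>flats M. rk M F = 1}. c F)"
  proof (rule sum.mono_neutral_right)
    show "\<forall>F\<in>flats M - ({F\<in>flats M. rk M F = 0} \<union> {F\<in>flats M. rk M F = 1}). c F = 0"
      using c_0 by force
  qed (use fin in auto)
  also have "\<dots> = (\<Sum>F\<in>{F\<in>flats M. rk M F = 0}. c F) + (\<Sum>F\<in>{F\<in>flats M. rk M F = 1}. c F)"
    by (rule sum.union_disjoint) (use fin in auto)
  also have "(\<Sum>F\<in>{F\<in>flats M. rk M F = 0}. c F) = whitney1 M 0 (int ?r - 1)"
  proof -
    have "{G\<in>flats M. int (rk M G) = int ?r - 1} = {G\<in>flats M. rk M G = ?r - 1}" using r by auto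
    then show ?thesis unfolding whitney1_def by (simp add: c_eq)
  qed
  also have "(\<Sum>F\<in>{F\<in>flats M. rk M F = 1}. c F) = - whitney1 M 1 (int ?r)"
    using r unfolding whitney1_def by (simp add: c_eq sum_negf)
  finally show ?thesis by simp
qed

text \<open>All summands have the same sign, so no cancellation occurs.\<close>

lemma abs_whitney1:
  assumes M: "is_matroid M"
  shows "\<bar>whitney1 M (int i) (int j)\<bar> = (-1) ^ (i + j) * whitney1 M (int i) (int j)"
proof -
  have "0 \<le> (-1) ^ (i + j) * whitney1 M (int i) (int j)"
    unfolding whitney1_def sum_distrib_left
  proof (intro sum_nonneg)
    fix F G assume "F \<in> {F \<in> flats M. int (rk M F) = int i}" "G \<in> {G \<in> flats M. int (rk M G) = int j}"
    then show "0 \<le> (-1) ^ (i + j) * flat_moebius M F G"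
      using moebius_sign[OF M, of F G] by (simp add: add.commute)
  qed
  then have "\<bar>(-1) ^ (i + j) * whitney1 M (int i) (int j)\<bar> = (-1) ^ (i + j) * whitney1 M (int i) (int j)"
    by simp
  then show ?thesis by (simp add: abs_mult power_abs)
qed

theorem theorem3p3:
  fixes M :: "'a matroid"
  assumes "is_matroid M"
  shows "coeff (inverse_KL M) 1 =
    \<bar>whitney1 M 1 (int (mrank M))\<bar> - \<bar>whitney1 M 0 (int (mrank M) - 1)\<bar>"
proof (cases "mrank M = 0")
  case True
  have no: "{F \<in> flats M. int (rk M F) = 1} = {}"
    \<comment> \<open>In rank 0 there is no degree r-1 to compare; \<open>Q\<close> is 1 and both
      Whitney numbers are empty sums.\<close>
    using rk_le_mrank[OF assms] True by fastforce
  have "whitney1 M 1 (int (mrank M)) = 0" unfolding whitney1_def no by simp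
  then show ?thesis using True assms
    by (simp add: inverse_KL_eq KL_rec_rank_0 whitney1_def)
next
  case False
  \<comment> \<open>Both index pairs, (1, r) and (0, r-1), have sum of the parity of n =
    r-1.\<close>
  then obtain n where n: "mrank M = Suc n" by (metis not0_implies_Suc)
  have "\<bar>whitney1 M 1 (int (mrank M))\<bar> = (-1) ^ n * whitney1 M 1 (int (mrank M))"
    using abs_whitney1[OF assms, of 1 "mrank M"] n by simp
  moreover have "\<bar>whitney1 M 0 (int (mrank M) - 1)\<bar> = (-1) ^ n * whitney1 M 0 (int (mrank M) - 1)"
    using abs_whitney1[OF assms, of 0 n] n by simp
  moreover have "coeff (KL_rec M) 1 = (-1) ^ n * ((-1) ^ n * coeff (KL_rec M) 1)"
    by (simp add: neg_one_power_cancel)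
  moreover have "(-1) ^ n * coeff (KL_rec M) 1
      = whitney1 M 1 (int (mrank M)) - whitney1 M 0 (int (mrank M) - 1)"
    using coeff_1_KL_rec[OF assms] n by simp
  ultimately show ?thesis unfolding inverse_KL_eq[OF assms] by (simp only: right_diff_distrib)
qed

end
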